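(* Let $D\subset\mathbb{R}^p$ be a measurable set and let $\phi:D\to[0,\infty)$ be a measurable function with $\int_D\phi(x)\,dx<\infty$. Put $L_\phi=\exp\left\{-\int_D\phi(x)\,dx\right\}$. Let $\kappa$ be a probability density function on $D$ (with respect to Lebesgue measure) with $\kappa(x)>0$ for all $x\in D$, let $C$ be a real constant with $C>\frac{\phi(x)}{\kappa(x)}$ for all $x\in D$, and let $a>1$. Let $K$ be a Poisson random variable with mean $aC$, and let $x_1,x_2,\dots$ be i.i.d. random variables with density $\kappa$, independent of $K$. Define the estimator $$\hat L_\phi=\prod_{i=1}^K\left(1-\frac{\phi(x_i)}{a\,C\,\kappa(x_i)}\right).$$ Then $$\mathrm{E}[\hat L_\phi]=\exp\left\{-\int_D\phi(x)\,dx\right\}$$ and $$\mathrm{Var}[\hat L_\phi]=L_\phi^2\left(\exp\left\{\frac{1}{a\,C}\int_D\frac{\phi(x)^2}{\kappa(x)}\,dx\right\}-1\right)\leq L_\phi^2\left(\exp\left\{\frac1a\int_D\phi(x)\,dx\right\}-1\right)<\infty.$$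
   Context: All integrals are with respect to Lebesgue measure on $\mathbb{R}^p$. The empty product (the case $K=0$) equals $1$. $\mathrm{E}$ and $\mathrm{Var}$ denote expectation and variance over the joint distribution of $K$ and $(x_i)_{i\ge1}$. *)

theory Defs
  imports "HOL-Probability.Probability"
begin

definition L_functional :: "(real^'p) set \<Rightarrow> (real^'p \<Rightarrow> real) \<Rightarrow> real" where
  "L_functional D \<phi> = exp (- (\<integral>y. \<phi> y \<partial>lebesgue_on D))"

text \<open>Functions on \<open>D\<close> are total functions on the ambient space of which only the values
  on \<open>D\<close> matter, and random variables in \<open>D\<close> are measurable maps into \<open>lebesgue_on D\<close>.
  Requiring Lebesgue rather than Borel measurability of the random variables makes \<open>f (X \<omega>)\<close> a
  random variable for every Lebesgue measurable \<open>f\<close>; on a complete probability space it is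
  automatic for Borel measurable random variables that have a density.\<close>

definition is_pdf_on :: "(real^'p) set \<Rightarrow> (real^'p \<Rightarrow> real) \<Rightarrow> bool" where
  "is_pdf_on D \<kappa> \<longleftrightarrow> \<kappa> \<in> borel_measurable (lebesgue_on D) \<and> (\<forall>y\<in>D. 0 \<le> \<kappa> y) \<and>
     (\<integral>\<^sup>+y. ennreal (\<kappa> y) \<partial>lebesgue_on D) = 1"

definition L_estimator ::
  "real \<Rightarrow> real \<Rightarrow> (real^'p \<Rightarrow> real) \<Rightarrow> (real^'p \<Rightarrow> real) \<Rightarrow>
   ('w \<Rightarrow> nat) \<Rightarrow> (nat \<Rightarrow> 'w \<Rightarrow> real^'p) \<Rightarrow> 'w \<Rightarrow> real" where
  "L_estimator a C \<phi> \<kappa> K x \<omega> =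
     (\<Prod>i\<in>{1..K \<omega>}. 1 - \<phi> (x i \<omega>) / (a * C * \<kappa> (x i \<omega>)))"

text \<open>Independence of two random variables with values in different types; the library's
  \<open>indep_var\<close> forces both to have the same value type.\<close>

definition indep_rv ::
  "'w measure \<Rightarrow> 'b measure \<Rightarrow> ('w \<Rightarrow> 'b) \<Rightarrow> 'c measure \<Rightarrow> ('w \<Rightarrow> 'c) \<Rightarrow> bool" where
  "indep_rv M S X T Y \<longleftrightarrow> X \<in> measurable M S \<and> Y \<in> measurable M T \<and>
     prob_space.indep_set M {X -` A \<inter> space M |A. A \<in> sets S} {Y -` B \<inter> space M |B. B \<in> sets T}"

end

theory Submission
  imports Defs
begin

text \<open>Conditionally on \<open>K = n\<close> a product \<open>\<Prod>i\<le>K. g (x\<^sub>i)\<close> of functions of i.i.d. variables has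
  mean \<open>m ^ n\<close> with \<open>m = E (g x\<^sub>1)\<close>, so for Poisson \<open>K\<close> of mean \<open>r\<close> its expectation is the Poisson
  generating function \<open>exp (r * (m - 1))\<close>. The first two moments of the estimator are the
  instances \<open>g = 1 - \<phi> / (a C \<kappa>)\<close> and its square; \<open>\<phi> / \<kappa> < C\<close> keeps \<open>g\<close> in \<open>[0, 1]\<close>, so that
  everything is integrable, and gives \<open>\<phi>\<^sup>2 / \<kappa> \<le> C \<phi>\<close> for the variance bound.\<close>

text \<open>The exponential series at \<open>r * z\<close>, scaled by \<open>exp (- r)\<close>.
  Stating it with \<open>sums\<close> yields both the value and the summability that the exchange of
  sum and expectation needs.\<close>

lemma poisson_pmf_generating_function:
  assumes "0 < r"
  shows "(\<lambda>n. pmf (poisson_pmf r) n * z ^ n) sums exp (r * (z - 1))"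
proof -
  have "(\<lambda>n. exp (- r) * ((r * z) ^ n /\<^sub>R fact n)) sums (exp (- r) * exp (r * z))"
    by (intro sums_mult exp_converges)
  moreover have "exp (- r) * ((r * z) ^ n /\<^sub>R fact n) = pmf (poisson_pmf r) n * z ^ n" for n
    using assms by (simp add: field_simps power_mult_distrib)
  moreover have "exp (- r) * exp (r * z) = exp (r * (z - 1))"
    by (simp add: exp_add [symmetric] algebra_simps)
  ultimately show ?thesis
    by simp
qed

text \<open>Composing with \<open>f\<close> and \<open>g\<close> only shrinks the generated
  sigma-algebras, and independence passes to subfamilies. The images share a value type, so
  \<open>indep_var\<close> and its product rule for expectations become available for variables that
  started in different types.\<close>

lemma (in prob_space) indep_rv_imp_indep_var_compose:
  assumes indep: "indep_rv M S X T Y"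
    and f: "f \<in> measurable S N" and g: "g \<in> measurable T N'"
  shows "indep_var N (\<lambda>\<omega>. f (X \<omega>)) N' (\<lambda>\<omega>. g (Y \<omega>))"
proof -
  have X: "X \<in> measurable M S" and Y: "Y \<in> measurable M T"
    and XY: "indep_set {X -` A \<inter> space M |A. A \<in> sets S} {Y -` B \<inter> space M |B. B \<in> sets T}"
    using indep by (auto simp: indep_rv_def)
  \<comment> \<open>It suffices to check the generators: a preimage under \<open>h\<close> after
    \<open>Z\<close> is a \<open>Z\<close>-preimage of a measurable set, and the
    \<open>Z\<close>-preimages of \<open>sets R\<close> already form a sigma-algebra.\<close>
  have pullback: "sigma_sets (space M) {(\<lambda>\<omega>. h (Z \<omega>)) -` A \<inter> space M |A. A \<in> sets Q}
      \<subseteq> {Z -` B \<inter> space M |B. B \<in> sets R}"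
    if Z: "Z \<in> measurable M R" and h: "h \<in> measurable R Q"
    for Z :: "'a \<Rightarrow> 'x" and h :: "'x \<Rightarrow> 'y" and R Q
  proof -
    have "{(\<lambda>\<omega>. h (Z \<omega>)) -` A \<inter> space M |A. A \<in> sets Q} \<subseteq> {Z -` B \<inter> space M |B. B \<in> sets R}"
    proof safe
      fix A assume A: "A \<in> sets Q"
      have "(\<lambda>\<omega>. h (Z \<omega>)) -` A \<inter> space M = Z -` (h -` A \<inter> space R) \<inter> space M"
        using measurable_space [OF Z] by auto
      then show "\<exists>B. (\<lambda>\<omega>. h (Z \<omega>)) -` A \<inter> space M = Z -` B \<inter> space M \<and> B \<in> sets R"
        using measurable_sets [OF h A] by blast
    qed
    then have "sigma_sets (space M) {(\<lambda>\<omega>. h (Z \<omega>)) -` A \<inter> space M |A. A \<in> sets Q}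
        \<subseteq> sigma_sets (space M) {Z -` B \<inter> space M |B. B \<in> sets R}"
      by (rule sigma_sets_mono')
    also have "\<dots> = {Z -` B \<inter> space M |B. B \<in> sets R}"
      using sigma_sets_vimage_commute [of Z "space M" "space R" "sets R"] measurable_space [OF Z]
      by (simp add: sets.sigma_sets_eq Pi_iff)
    finally show ?thesis .
  qed
  have "indep_set (sigma_sets (space M) {(\<lambda>\<omega>. f (X \<omega>)) -` A \<inter> space M |A. A \<in> sets N})
      (sigma_sets (space M) {(\<lambda>\<omega>. g (Y \<omega>)) -` B \<inter> space M |B. B \<in> sets N'})"
    unfolding indep_set_def
    by (rule indep_sets_mono_sets [OF XY [unfolded indep_set_def]])
      (use pullback [OF X f] pullback [OF Y g] in \<open>simp split: bool.split\<close>)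
  then show ?thesis
    unfolding indep_var_eq using X Y f g by (auto intro: measurable_compose)
qed

text \<open>The sample space is cut into the events \<open>K = n\<close>, and the resulting series
  is integrated term by term. The bounds on \<open>g\<close> make each term integrable and
  nonnegative, so absolute convergence reduces to the Poisson series itself. Leaving
  \<open>g\<close> general allows the same argument to serve both moments.\<close>

lemma (in prob_space) expectation_poisson_prod:
  fixes K :: "'a \<Rightarrow> nat" and x :: "nat \<Rightarrow> 'a \<Rightarrow> 'b" and g :: "'b \<Rightarrow> real"
  assumes r: "0 < r"
    and K_poisson: "distr M (count_space UNIV) K = measure_pmf (poisson_pmf r)"
    and x_indep: "indep_vars (\<lambda>_. N) x {1..}"
    and K_x_indep: "indep_rv M (count_space UNIV) K (PiM {1..} (\<lambda>_. N)) (\<lambda>\<omega>. \<lambda>i\<in>{1..}. x i \<omega>)"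
    and g_meas: "g \<in> borel_measurable N"
    and g_bounds: "\<And>y. y \<in> space N \<Longrightarrow> 0 \<le> g y \<and> g y \<le> 1"
    and mean: "\<And>i. 1 \<le> i \<Longrightarrow> expectation (\<lambda>\<omega>. g (x i \<omega>)) = m"
  shows "integrable M (\<lambda>\<omega>. \<Prod>i\<in>{1..K \<omega>}. g (x i \<omega>))"
    and "expectation (\<lambda>\<omega>. \<Prod>i\<in>{1..K \<omega>}. g (x i \<omega>)) = exp (r * (m - 1))"
proof -
  define P where "P n \<omega> = (\<Prod>i\<in>{1..n}. g (x i \<omega>))" for n \<omega>
  \<comment> \<open>The slice of the random product on \<open>K = n\<close>; there the number of
    factors is the constant \<open>n\<close>.\<close>
  define Q where "Q n \<omega> = indicator {n} (K \<omega>) * P n \<omega>" for n \<omega>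
  have K[measurable]: "K \<in> measurable M (count_space UNIV)"
    using K_x_indep by (simp add: indep_rv_def)
  have x: "x i \<in> measurable M N" if "1 \<le> i" for i
    using x_indep that by (auto simp: indep_vars_def)
  have gx[measurable]: "(\<lambda>\<omega>. g (x i \<omega>)) \<in> borel_measurable M" if "1 \<le> i" for i
    using measurable_compose [OF x [OF that] g_meas] .
  have gx_bounds: "0 \<le> g (x i \<omega>) \<and> g (x i \<omega>) \<le> 1" if "1 \<le> i" "\<omega> \<in> space M" for i \<omega>
    using g_bounds measurable_space [OF x] that by blast
  have P_meas[measurable]: "P n \<in> borel_measurable M" for n
    unfolding P_def by (intro borel_measurable_prod gx) auto
  have P_bounds: "0 \<le> P n \<omega> \<and> P n \<omega> \<le> 1" if "\<omega> \<in> space M" for n \<omega>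
    unfolding P_def using gx_bounds that by (auto intro!: prod_nonneg prod_le_1)
  have P_int: "integrable M (P n)" for n
    by (rule integrable_const_bound [where B = 1]) (use P_bounds in \<open>auto intro!: AE_I2\<close>)
  have EP: "expectation (P n) = m ^ n" for n
  proof -
    \<comment> \<open>Independence is inherited by the first \<open>n\<close> variables and by their
      images under \<open>g\<close>, so the mean of the product factors; \<open>n = 0\<close> gives
      the empty product and \<open>m ^ 0\<close>.\<close>
    have "indep_vars (\<lambda>_. borel) (\<lambda>i \<omega>. g (x i \<omega>)) {1..n}"
      using indep_vars_compose2 [OF indep_vars_subset [OF x_indep, of "{1..n}"], of "\<lambda>_. g"]
        g_meas by auto
    moreover have "integrable M (\<lambda>\<omega>. g (x i \<omega>))" if "i \<in> {1..n}" for i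
      by (rule integrable_const_bound [where B = 1])
        (use gx_bounds gx that in \<open>auto intro!: AE_I2\<close>)
    ultimately have "expectation (P n) = (\<Prod>i\<in>{1..n}. expectation (\<lambda>\<omega>. g (x i \<omega>)))"
      unfolding P_def by (intro indep_vars_lebesgue_integral) auto
    also have "\<dots> = m ^ n"
      using mean by simp
    finally show ?thesis .
  qed
  have EK: "expectation (\<lambda>\<omega>. indicator {n} (K \<omega>)) = pmf (poisson_pmf r) n" for n
  proof -
    have "expectation (\<lambda>\<omega>. indicator {n} (K \<omega>) :: real)
        = (\<integral>k. indicator {n} k \<partial>distr M (count_space UNIV) K)"
      by (subst integral_distr) simp_all
    then show ?thesis
      unfolding K_poisson by (simp add: measure_pmf_single)
  qed
  have K_int: "integrable M (\<lambda>\<omega>. indicator {n} (K \<omega>) :: real)" for n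
    by (rule integrable_const_bound [where B = 1]) (auto simp: indicator_def)
  have K_P: "indep_var borel (\<lambda>\<omega>. indicator {n} (K \<omega>) :: real) borel (P n)" for n
  proof -
    \<comment> \<open>\<open>P n\<close> is a measurable function of the whole sequence that reads
      only the coordinates \<open>1..n\<close>. Hence independence of \<open>K\<close> from the
      sequence gives independence of \<open>K\<close> from \<open>P n\<close>.\<close>
    have "(\<lambda>f. \<Prod>i\<in>{1..n}. g (f i)) \<in> borel_measurable (PiM {1..} (\<lambda>_. N))"
      by (intro borel_measurable_prod measurable_compose [OF _ g_meas] measurable_component_singleton)
        auto
    from indep_rv_imp_indep_var_compose [OF K_x_indep _ this, of "indicator {n}" borel]
    show ?thesis
      by (simp add: P_def [abs_def])
  qed
  have Q_int: "integrable M (Q n)" and EQ: "expectation (Q n) = pmf (poisson_pmf r) n * m ^ n" for n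
    unfolding Q_def using indep_var_integrable [OF K_P K_int P_int]
      indep_var_lebesgue_integral [OF K_P K_int P_int] by (simp_all add: EK EP)
  \<comment> \<open>\<open>Q n\<close> is nonnegative on the sample space, so the series of absolute
    means is again the Poisson series.\<close>
  have EQ_norm: "expectation (\<lambda>\<omega>. norm (Q n \<omega>)) = pmf (poisson_pmf r) n * m ^ n" for n
  proof -
    have "expectation (\<lambda>\<omega>. norm (Q n \<omega>)) = expectation (Q n)"
      using P_bounds by (intro Bochner_Integration.integral_cong) (auto simp: Q_def)
    then show ?thesis
      by (simp add: EQ)
  qed
  \<comment> \<open>For fixed \<omega> only the term \<open>n = K \<omega>\<close> survives, so
    pointwise convergence is trivial.\<close>
  have Q_sums: "(\<lambda>n. Q n \<omega>) sums P (K \<omega>) \<omega>" for \<omega>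
  proof -
    have "Q n \<omega> = (if n = K \<omega> then P n \<omega> else 0)" for n
      by (simp add: Q_def indicator_def)
    then show ?thesis
      using sums_single [of "K \<omega>" "\<lambda>n. P n \<omega>"] by simp
  qed
  have summ: "AE \<omega> in M. summable (\<lambda>n. norm (Q n \<omega>))"
  proof (rule AE_I2)
    fix \<omega>
    show "summable (\<lambda>n. norm (Q n \<omega>))"
      by (rule summable_finite [of "{K \<omega>}"]) (auto simp: Q_def)
  qed
  have gf: "(\<lambda>n. pmf (poisson_pmf r) n * m ^ n) sums exp (r * (m - 1))"
    using poisson_pmf_generating_function [OF r] .
  then have summ_E: "summable (\<lambda>n. expectation (\<lambda>\<omega>. norm (Q n \<omega>)))"
    unfolding EQ_norm by (rule sums_summable)
  have suminf_Q: "(\<lambda>\<omega>. \<Sum>n. Q n \<omega>) = (\<lambda>\<omega>. \<Prod>i\<in>{1..K \<omega>}. g (x i \<omega>))"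
    using Q_sums by (auto simp: sums_iff P_def)
  show "integrable M (\<lambda>\<omega>. \<Prod>i\<in>{1..K \<omega>}. g (x i \<omega>))"
    using integrable_suminf [OF Q_int summ summ_E] by (simp add: suminf_Q)
  show "expectation (\<lambda>\<omega>. \<Prod>i\<in>{1..K \<omega>}. g (x i \<omega>)) = exp (r * (m - 1))"
    using sums_unique2 [OF sums_integral [OF Q_int summ summ_E]] gf by (simp add: suminf_Q EQ)
qed

theorem theorem3p1:
  fixes D :: "(real^'p) set"
    and \<phi> \<kappa> :: "real^'p \<Rightarrow> real"
    and a C :: real
    and M :: "'w measure"
    and K :: "'w \<Rightarrow> nat"
    and x :: "nat \<Rightarrow> 'w \<Rightarrow> real^'p"
  assumes D: "D \<in> sets lebesgue"
    and \<phi>_meas: "\<phi> \<in> borel_measurable (lebesgue_on D)"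
    and \<phi>_nonneg: "\<And>y. y \<in> D \<Longrightarrow> 0 \<le> \<phi> y"
    and \<phi>_int: "(\<integral>\<^sup>+y. ennreal (\<phi> y) \<partial>lebesgue_on D) < \<infinity>"
    and \<kappa>_pdf: "is_pdf_on D \<kappa>"
    and \<kappa>_pos: "\<And>y. y \<in> D \<Longrightarrow> 0 < \<kappa> y"
    and C: "\<And>y. y \<in> D \<Longrightarrow> \<phi> y / \<kappa> y < C"
    and a: "1 < a"
    and M: "prob_space M"
    and K_meas: "K \<in> measurable M (count_space UNIV)"
    and K_poisson: "distr M (count_space UNIV) K = measure_pmf (poisson_pmf (a * C))"
    and x_density: "\<And>i. 1 \<le> i \<Longrightarrow> distributed M (lebesgue_on D) (x i) (\<lambda>y. ennreal (\<kappa> y))"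
    and x_indep: "prob_space.indep_vars M (\<lambda>_. lebesgue_on D) x {1..}"
    and K_x_indep: "indep_rv M (count_space UNIV) K
           (PiM {1..} (\<lambda>_. lebesgue_on D)) (\<lambda>\<omega>. \<lambda>i\<in>{1..}. x i \<omega>)"
  shows "integrable M (L_estimator a C \<phi> \<kappa> K x) \<and>
    prob_space.expectation M (L_estimator a C \<phi> \<kappa> K x) = exp (- (\<integral>y. \<phi> y \<partial>lebesgue_on D)) \<and>
    integrable M (\<lambda>\<omega>. (L_estimator a C \<phi> \<kappa> K x \<omega>)\<^sup>2) \<and>
    integrable (lebesgue_on D) (\<lambda>y. (\<phi> y)\<^sup>2 / \<kappa> y) \<and>
    prob_space.variance M (L_estimator a C \<phi> \<kappa> K x) =
           (L_functional D \<phi>)\<^sup>2 *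
             (exp (1 / (a * C) * (\<integral>y. (\<phi> y)\<^sup>2 / \<kappa> y \<partial>lebesgue_on D)) - 1) \<and>
    (L_functional D \<phi>)\<^sup>2 *
             (exp (1 / (a * C) * (\<integral>y. (\<phi> y)\<^sup>2 / \<kappa> y \<partial>lebesgue_on D)) - 1)
           \<le> (L_functional D \<phi>)\<^sup>2 * (exp (1 / a * (\<integral>y. \<phi> y \<partial>lebesgue_on D)) - 1) \<and>
    ereal ((L_functional D \<phi>)\<^sup>2 * (exp (1 / a * (\<integral>y. \<phi> y \<partial>lebesgue_on D)) - 1)) < \<infinity>"
proof -
  interpret prob_space M by (fact M)
  let ?N = "lebesgue_on D"
  let ?L = "L_estimator a C \<phi> \<kappa> K x"
  define I where "I = (\<integral>y. \<phi> y \<partial>?N)"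
  define J where "J = (\<integral>y. (\<phi> y)\<^sup>2 / \<kappa> y \<partial>?N)"
  define g where "g y = 1 - \<phi> y / (a * C * \<kappa> y)" for y
  have space_N: "space ?N = D"
    by simp
  note \<phi>_meas [measurable]
  have \<kappa>_meas[measurable]: "\<kappa> \<in> borel_measurable ?N"
    and \<kappa>_mass: "(\<integral>\<^sup>+y. ennreal (\<kappa> y) \<partial>?N) = 1"
    using \<kappa>_pdf by (auto simp: is_pdf_on_def)
  \<comment> \<open>Positivity of \<open>C\<close> has to be read off at some point of
    \<open>D\<close>, where \<open>C\<close> exceeds a nonnegative quotient. Total mass 1 of the
    density provides such a point.\<close>
  have "D \<noteq> {}"
  proof
    assume "D = {}"
    then have "(\<integral>\<^sup>+y. ennreal (\<kappa> y) \<partial>?N) = 0"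
      by (subst nn_integral_empty) auto
    then show False
      using \<kappa>_mass by simp
  qed
  then obtain y\<^sub>0 where "y\<^sub>0 \<in> D"
    by blast
  then have C_pos: "0 < C"
    using C [of y\<^sub>0] \<phi>_nonneg [of y\<^sub>0] \<kappa>_pos [of y\<^sub>0] by (meson divide_nonneg_pos le_less_trans)
  have \<phi>_bound: "\<phi> y \<le> C * \<kappa> y" if "y \<in> D" for y
    using C [OF that] \<kappa>_pos [OF that] by (simp add: field_simps)
  have \<phi>_integrable: "integrable ?N \<phi>"
    by (rule integrableI_nonneg) (use \<phi>_int \<phi>_nonneg space_N in \<open>auto intro!: AE_I2\<close>)
  have \<kappa>_integrable: "integrable ?N \<kappa>"
    by (rule integrableI_nonneg) (use \<kappa>_mass \<kappa>_pos space_N in \<open>auto intro!: AE_I2 less_imp_le\<close>)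
  have \<kappa>_integral: "(\<integral>y. \<kappa> y \<partial>?N) = 1"
    using \<kappa>_mass \<kappa>_pos space_N
    by (subst integral_eq_nn_integral) (auto intro!: AE_I2 less_imp_le)
  \<comment> \<open>Multiply \<phi> \<le> C \<kappa> by \<phi> and divide by \<kappa>. This one
    bound gives both integrability of \<open>(\<phi> y)\<^sup>2 / \<kappa> y\<close> and the final
    variance estimate.\<close>
  have sq_bound: "0 \<le> (\<phi> y)\<^sup>2 / \<kappa> y" "(\<phi> y)\<^sup>2 / \<kappa> y \<le> C * \<phi> y" if "y \<in> D" for y
    using \<phi>_nonneg [OF that] \<kappa>_pos [OF that] mult_left_mono [OF \<phi>_bound [OF that] \<phi>_nonneg [OF that]]
    by (auto simp: field_simps power2_eq_square)
  have sq_integrable: "integrable ?N (\<lambda>y. (\<phi> y)\<^sup>2 / \<kappa> y)"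
  proof (rule Bochner_Integration.integrable_bound)
    show "integrable ?N (\<lambda>y. C * \<phi> y)"
      using \<phi>_integrable by simp
    show "AE y in ?N. norm ((\<phi> y)\<^sup>2 / \<kappa> y) \<le> norm (C * \<phi> y)"
      using sq_bound space_N by (intro AE_I2) (metis abs_of_nonneg order_trans real_norm_def)
  qed measurable
  have "J \<le> (\<integral>y. C * \<phi> y \<partial>?N)"
    unfolding J_def using sq_integrable \<phi>_integrable sq_bound space_N
    by (intro integral_mono) auto
  then have J_le: "J \<le> C * I"
    by (simp add: I_def)
  have g_meas[measurable]: "g \<in> borel_measurable ?N"
    unfolding g_def by measurable
  have g_bounds: "0 \<le> g y \<and> g y \<le> 1" if "y \<in> D" for y
  proof -
    \<comment> \<open>Since \<open>a > 1\<close>, the factor \<open>a\<close> only enlarges the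
      bound on \<phi>, which keeps \<open>g\<close> nonnegative; \<open>g y \<le> 1\<close> comes
      from \<phi> \<ge> 0.\<close>
    have "C * \<kappa> y \<le> a * C * \<kappa> y"
      using a C_pos \<kappa>_pos [OF that] by simp
    then have "\<phi> y \<le> a * C * \<kappa> y"
      using \<phi>_bound [OF that] by linarith
    then show ?thesis
      using a C_pos \<kappa>_pos [OF that] \<phi>_nonneg [OF that] by (simp add: g_def field_simps)
  qed
  have transfer: "expectation (\<lambda>\<omega>. h (x i \<omega>)) = (\<integral>y. \<kappa> y * h y \<partial>?N)"
    if "1 \<le> i" "h \<in> borel_measurable ?N" for i and h :: "_ \<Rightarrow> real"
    using distributed_integral [OF x_density [OF that(1)] that(2)] \<kappa>_pos space_N
    by (simp add: less_imp_le)
  have mean1: "expectation (\<lambda>\<omega>. g (x i \<omega>)) = 1 - I / (a * C)" if "1 \<le> i" for i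
  proof -
    have "expectation (\<lambda>\<omega>. g (x i \<omega>)) = (\<integral>y. \<kappa> y * g y \<partial>?N)"
      using that by (intro transfer) auto
    \<comment> \<open>The density cancels the \<kappa> in the denominator of \<open>g\<close>, which
      is why the mean involves \<kappa> only through its total mass.\<close>
    also have "\<dots> = (\<integral>y. \<kappa> y - \<phi> y / (a * C) \<partial>?N)"
      using \<kappa>_pos a C_pos space_N
      by (intro Bochner_Integration.integral_cong) (force simp: g_def field_simps)+
    also have "\<dots> = 1 - I / (a * C)"
      using \<kappa>_integrable \<phi>_integrable by (simp add: \<kappa>_integral I_def)
    finally show ?thesis .
  qed
  \<comment> \<open>The linear combination that arises on expanding
    \<open>\<kappa> y * (g y)\<^sup>2\<close>; it is used with \<open>c = 2 / (a * C)\<close> and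
    \<open>d = 1 / (a * C)\<^sup>2\<close>.\<close>
  have lin: "(\<integral>y. \<kappa> y - c * \<phi> y + d * ((\<phi> y)\<^sup>2 / \<kappa> y) \<partial>?N) = 1 - c * I + d * J" for c d
  proof -
    have "integrable ?N (\<lambda>y. c * \<phi> y)" "integrable ?N (\<lambda>y. d * ((\<phi> y)\<^sup>2 / \<kappa> y))"
      by (intro integrable_mult_right \<phi>_integrable sq_integrable)+
    then show ?thesis
      by (subst Bochner_Integration.integral_add)
        (use \<kappa>_integrable \<kappa>_integral in \<open>simp_all only: Bochner_Integration.integral_diff
          Bochner_Integration.integrable_diff integral_mult_right_zero I_def J_def\<close>)
  qed
  have mean2: "expectation (\<lambda>\<omega>. (g (x i \<omega>))\<^sup>2) = 1 - 2 * I / (a * C) + J / (a * C)\<^sup>2" if "1 \<le> i" for i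
  proof -
    have "expectation (\<lambda>\<omega>. (g (x i \<omega>))\<^sup>2) = (\<integral>y. \<kappa> y * (g y)\<^sup>2 \<partial>?N)"
      using that by (intro transfer) auto
    also have "\<dots> = (\<integral>y. \<kappa> y - 2 / (a * C) * \<phi> y + 1 / (a * C)\<^sup>2 * ((\<phi> y)\<^sup>2 / \<kappa> y) \<partial>?N)"
    proof (rule Bochner_Integration.integral_cong [OF refl])
      fix y assume "y \<in> space ?N"
      then have "\<kappa> y \<noteq> 0"
        using \<kappa>_pos space_N by force
      then show "\<kappa> y * (g y)\<^sup>2 = \<kappa> y - 2 / (a * C) * \<phi> y + 1 / (a * C)\<^sup>2 * ((\<phi> y)\<^sup>2 / \<kappa> y)"
        using a C_pos by (simp add: g_def field_simps power2_eq_square)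
    qed
    also have "\<dots> = 1 - 2 / (a * C) * I + 1 / (a * C)\<^sup>2 * J"
      by (rule lin)
    finally show ?thesis
      by simp
  qed
  have aC: "0 < a * C"
    using a C_pos by simp
  have L_eq: "?L = (\<lambda>\<omega>. \<Prod>i\<in>{1..K \<omega>}. g (x i \<omega>))"
    by (simp add: L_estimator_def [abs_def] g_def)
  have L_sq_eq: "(\<lambda>\<omega>. (?L \<omega>)\<^sup>2) = (\<lambda>\<omega>. \<Prod>i\<in>{1..K \<omega>}. (g (x i \<omega>))\<^sup>2)"
    by (simp add: L_eq prod_power_distrib)
  note moment = expectation_poisson_prod [OF aC K_poisson x_indep K_x_indep]
  have L_int: "integrable M ?L" and "expectation ?L = exp (a * C * ((1 - I / (a * C)) - 1))"
    unfolding L_eq using g_bounds mean1 by (intro moment; auto)+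
  then have EL: "expectation ?L = exp (- I)"
    using a C_pos by simp
  have g2_bounds: "0 \<le> (g y)\<^sup>2 \<and> (g y)\<^sup>2 \<le> 1" if "y \<in> D" for y
    using g_bounds [OF that] by (simp add: power_le_one)
  have L2_int: "integrable M (\<lambda>\<omega>. (?L \<omega>)\<^sup>2)"
    and "expectation (\<lambda>\<omega>. (?L \<omega>)\<^sup>2) = exp (a * C * ((1 - 2 * I / (a * C) + J / (a * C)\<^sup>2) - 1))"
    unfolding L_sq_eq using g2_bounds mean2
    by (intro moment [where g = "\<lambda>y. (g y)\<^sup>2"]; auto)+
  \<comment> \<open>The exponent is written with \<open>- I\<close> twice so that
    \<open>exp_add\<close> splits off exactly \<open>(exp (- I))\<^sup>2\<close>, the square of the
    mean.\<close>
  moreover have "a * C * ((1 - 2 * I / (a * C) + J / (a * C)\<^sup>2) - 1) = - I + - I + 1 / (a * C) * J"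
    using a C_pos by (simp add: field_simps power2_eq_square)
  ultimately have EL2: "expectation (\<lambda>\<omega>. (?L \<omega>)\<^sup>2) = (exp (- I))\<^sup>2 * exp (1 / (a * C) * J)"
    by (simp only: exp_add power2_eq_square)
  have "variance ?L = (exp (- I))\<^sup>2 * (exp (1 / (a * C) * J) - 1)"
    using variance_eq [OF L_int L2_int] by (simp add: EL EL2 algebra_simps)
  \<comment> \<open>This is \<open>J \<le> C * I\<close> divided by \<open>a * C\<close>;
    monotonicity of \<open>exp\<close> then turns it into the claimed variance bound.\<close>
  moreover have "1 / (a * C) * J \<le> 1 / a * I"
    using J_le a C_pos by (simp add: field_simps)
  ultimately show ?thesis
    using L_int EL L2_int sq_integrable
    by (simp add: L_functional_def I_def [symmetric] J_def [symmetric])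
qed

end
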